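(* Define square matrices $RE_{k,q}$ and $RE_{k,q}'$ ($k\in\{0,1,2\}$) of size $2^q\times 2^q$ with entries in $\mathbb{Z}[x,y]$ recursively for integers $q\ge 0$ by $RE_{0,0}=\begin{bmatrix}1\end{bmatrix}$, $RE_{1,0}=\begin{bmatrix}0\end{bmatrix}$, $RE_{2,0}=\begin{bmatrix}0\end{bmatrix}$, $RE_{0,0}'=\begin{bmatrix}0\end{bmatrix}$, $RE_{1,0}'=\begin{bmatrix}1\end{bmatrix}$, $RE_{2,0}'=\begin{bmatrix}0\end{bmatrix}$, and, in block form with blocks of size $2^q\times 2^q$ (where $\mathbf{0}$ is the zero block), \[ RE_{0,q+1}=\begin{bmatrix} RE_{1,q}+RE_{2,q} & xRE_{0,q}\\ RE_{0,q} & \mathbf{0}\end{bmatrix},\quad RE_{0,q+1}'=\begin{bmatrix} RE_{1,q}'+RE_{2,q}' & xRE_{0,q}'\\ RE_{0,q}' & \mathbf{0}\end{bmatrix}, \] \[ RE_{1,q+1}=\begin{bmatrix} RE_{2,q} & xRE_{0,q}\\ RE_{0,q} & \mathbf{0}\end{bmatrix},\quad RE_{1,q+1}'=\begin{bmatrix} RE_{2,q}' & xRE_{0,q}'\\ RE_{0,q}' & \mathbf{0}\end{bmatrix}, \] \[ RE_{2,q+1}=\begin{bmatrix} yRE_{0,q} & \mathbf{0}\\ \mathbf{0} & \mathbf{0}\end{bmatrix},\quad RE_{2,q+1}'=\begin{bmatrix} yRE_{0,q}' & \mathbf{0}\\ \mathbf{0} & \mathbf{0}\end{bmatrix}. \]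 Then for all positive integers $m,n$, the generating polynomial of Domineering Right ends on an $m\times n$ board is the $(1,1)$ entry of $(RE_{0,n}+RE_{0,n}')^m$.
   Context: An $m\times n$ board is a rectangular grid of unit squares with $m$ rows and $n$ columns. A Domineering position on the board is a set of pairwise non-overlapping dominoes placed on the board, each domino covering exactly two squares sharing an edge; Left's dominoes are vertical (two squares in the same column, in consecutive rows) and Right's dominoes are horizontal (two squares in the same row, in consecutive columns). Alternating play is not assumed, so any such set of dominoes (including the empty set) is a position. A Right end is a position in which Right cannot place a further domino, i.e., no two horizontally adjacent squares are both empty (Left may or may not still have moves). The generating polynomial of Right ends is $\sum_{a,b\ge 0} r(a,b)\,x^a y^b$, where $r(a,b)$ is the number of Right ends on the $m\times n$ board with exactly $a$ vertical (Left) dominoes and $b$ horizontal (Right) dominoes. *)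

theory Defs
  imports
    "Jordan_Normal_Form.Matrix"
    "HOL-Library.Groups_Big_Fun"
    "HOL-Computational_Algebra.Polynomial"
begin

section \<open>Domineering positions\<close>

text \<open>A square is a pair (row, column), counted from 0.\<close>

type_synonym square = "nat \<times> nat"

definition board :: "nat \<Rightarrow> nat \<Rightarrow> square set" where
  "board m n = {0..<m} \<times> {0..<n}"

definition vertical :: "square set \<Rightarrow> bool" where
  "vertical d \<longleftrightarrow> (\<exists>i j. d = {(i, j), (Suc i, j)})"

definition horizontal :: "square set \<Rightarrow> bool" where
  "horizontal d \<longleftrightarrow> (\<exists>i j. d = {(i, j), (i, Suc j)})"

definition position :: "nat \<Rightarrow> nat \<Rightarrow> square set set \<Rightarrow> bool" where
  "position m n P \<longleftrightarrow>
     (\<forall>d\<in>P. d \<subseteq> board m n \<and> (vertical d \<or> horizontal d)) \<and>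
     (\<forall>d\<in>P. \<forall>e\<in>P. d \<noteq> e \<longrightarrow> d \<inter> e = {})"

definition right_end :: "nat \<Rightarrow> nat \<Rightarrow> square set set \<Rightarrow> bool" where
  "right_end m n P \<longleftrightarrow>
     position m n P \<and> \<not> (\<exists>d. horizontal d \<and> d \<subseteq> board m n \<and> d \<inter> \<Union>P = {})"

definition num_right_ends :: "nat \<Rightarrow> nat \<Rightarrow> nat \<Rightarrow> nat \<Rightarrow> nat" where
  "num_right_ends m n a b =
     card {P. right_end m n P \<and> card {d \<in> P. vertical d} = a \<and> card {d \<in> P. horizontal d} = b}"


section \<open>The generating polynomial\<close>

text \<open>The ring of integer polynomials in two variables is represented as \<^typ>\<open>int poly poly\<close>: the
  coefficients are polynomials in the first variable, the outer variable is the second one.\<close>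

definition var_x :: "int poly poly" where
  "var_x = [:[:0, 1:]:]"

definition var_y :: "int poly poly" where
  "var_y = [:0, 1:]"

text \<open>\<^const>\<open>Sum_any\<close> sums over all pairs (a, b) of naturals. It would be 0 if infinitely many
  summands were nonzero; the lemmas below show that this does not happen.\<close>

definition right_end_gf :: "nat \<Rightarrow> nat \<Rightarrow> int poly poly" where
  "right_end_gf m n =
     Sum_any (\<lambda>(a, b). of_nat (num_right_ends m n a b) * var_x ^ a * var_y ^ b)"

lemma finite_right_ends: "finite {P. right_end m n P}"
proof (rule finite_subset)
  show "{P. right_end m n P} \<subseteq> Pow (Pow (board m n))"
    by (auto simp: right_end_def position_def)
qed (simp add: board_def)

lemma finite_num_right_ends: "finite {(a, b). num_right_ends m n a b \<noteq> 0}"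
proof (rule finite_subset)
  show "{(a, b). num_right_ends m n a b \<noteq> 0} \<subseteq>
    (\<lambda>P. (card {d \<in> P. vertical d}, card {d \<in> P. horizontal d})) ` {P. right_end m n P}"
  proof
    fix p assume "p \<in> {(a, b). num_right_ends m n a b \<noteq> 0}"
    then obtain a b where p: "p = (a, b)" and "num_right_ends m n a b \<noteq> 0"
      by auto
    then have "{P. right_end m n P \<and> card {d \<in> P. vertical d} = a \<and>
        card {d \<in> P. horizontal d} = b} \<noteq> {}"
      unfolding num_right_ends_def by (metis card.empty)
    then show "p \<in> (\<lambda>P. (card {d \<in> P. vertical d}, card {d \<in> P. horizontal d})) `
        {P. right_end m n P}"
      by (auto simp: p)
  qed
qed (simp add: finite_right_ends)

lemma right_end_gf_summand:
  "of_nat r * var_x ^ a * var_y ^ b = monom (monom (int r) a) b"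
proof -
  have x: "var_x = monom (monom 1 1) 0" and y: "var_y = monom 1 1"
    by (simp_all add: var_x_def var_y_def monom_altdef)
  have r: "(of_nat r :: int poly poly) = monom (monom (int r) 0) 0"
    by (simp add: of_nat_poly monom_0)
  have xa: "var_x ^ a = monom (monom 1 a) 0" and yb: "var_y ^ b = monom 1 b"
    unfolding x y by (simp_all only: monom_power power_one mult_1 mult_0)
  show ?thesis
    unfolding r xa yb by (simp only: mult_monom mult_1_right add_0 add_0_right)
qed

lemma coeff_right_end_gf:
  "coeff (coeff (right_end_gf m n) b) a = int (num_right_ends m n a b)"
proof -
  define S where "S = {p. num_right_ends m n (fst p) (snd p) \<noteq> 0}"
  define f where "f = (\<lambda>p. int (num_right_ends m n (fst p) (snd p)))"
  have S: "finite S"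
    using finite_num_right_ends[of m n] by (simp only: S_def case_prod_unfold)
  have "right_end_gf m n = Sum_any (\<lambda>p. monom (monom (f p) (fst p)) (snd p))"
    by (simp only: right_end_gf_def case_prod_unfold right_end_gf_summand f_def)
  also have "\<dots> = (\<Sum>p\<in>S. monom (monom (f p) (fst p)) (snd p))"
    by (rule Sum_any.expand_superset[OF S]) (auto simp: S_def f_def)
  finally have "coeff (coeff (right_end_gf m n) b) a =
      (\<Sum>p\<in>S. coeff (coeff (monom (monom (f p) (fst p)) (snd p)) b) a)"
    by (simp only: coeff_sum)
  also have "\<dots> = (\<Sum>p\<in>S. if p = (a, b) then f p else 0)"
    by (rule sum.cong) (auto simp: prod_eq_iff)
  also have "\<dots> = (if (a, b) \<in> S then f (a, b) else 0)"
    using S by simp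
  also have "\<dots> = int (num_right_ends m n a b)"
    by (simp add: S_def f_def)
  finally show ?thesis .
qed

section \<open>The matrices\<close>

fun RE0 :: "nat \<Rightarrow> int poly poly mat"
  and RE1 :: "nat \<Rightarrow> int poly poly mat"
  and RE2 :: "nat \<Rightarrow> int poly poly mat"
where
  "RE0 0 = 1\<^sub>m 1"
| "RE1 0 = 0\<^sub>m 1 1"
| "RE2 0 = 0\<^sub>m 1 1"
| "RE0 (Suc q) =
     four_block_mat (RE1 q + RE2 q) (var_x \<cdot>\<^sub>m RE0 q)
                    (RE0 q)         (0\<^sub>m (2 ^ q) (2 ^ q))"
| "RE1 (Suc q) =
     four_block_mat (RE2 q) (var_x \<cdot>\<^sub>m RE0 q)
                    (RE0 q) (0\<^sub>m (2 ^ q) (2 ^ q))"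
| "RE2 (Suc q) =
     four_block_mat (var_y \<cdot>\<^sub>m RE0 q)      (0\<^sub>m (2 ^ q) (2 ^ q))
                    (0\<^sub>m (2 ^ q) (2 ^ q)) (0\<^sub>m (2 ^ q) (2 ^ q))"

fun RE0' :: "nat \<Rightarrow> int poly poly mat"
  and RE1' :: "nat \<Rightarrow> int poly poly mat"
  and RE2' :: "nat \<Rightarrow> int poly poly mat"
where
  "RE0' 0 = 0\<^sub>m 1 1"
| "RE1' 0 = 1\<^sub>m 1"
| "RE2' 0 = 0\<^sub>m 1 1"
| "RE0' (Suc q) =
     four_block_mat (RE1' q + RE2' q) (var_x \<cdot>\<^sub>m RE0' q)
                    (RE0' q)          (0\<^sub>m (2 ^ q) (2 ^ q))"
| "RE1' (Suc q) =
     four_block_mat (RE2' q) (var_x \<cdot>\<^sub>m RE0' q)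
                    (RE0' q) (0\<^sub>m (2 ^ q) (2 ^ q))"
| "RE2' (Suc q) =
     four_block_mat (var_y \<cdot>\<^sub>m RE0' q)     (0\<^sub>m (2 ^ q) (2 ^ q))
                    (0\<^sub>m (2 ^ q) (2 ^ q)) (0\<^sub>m (2 ^ q) (2 ^ q))"

lemma RE_carrier:
  "RE0 q \<in> carrier_mat (2 ^ q) (2 ^ q) \<and>
   RE1 q \<in> carrier_mat (2 ^ q) (2 ^ q) \<and>
   RE2 q \<in> carrier_mat (2 ^ q) (2 ^ q)"
proof (induction q)
  case 0
  show ?case
    unfolding RE0.simps RE1.simps RE2.simps power_0
    by (intro conjI one_carrier_mat zero_carrier_mat)
next
  case (Suc q)
  then show ?case
    unfolding RE0.simps RE1.simps RE2.simps power_Suc mult_2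
    by (intro conjI four_block_carrier_mat add_carrier_mat smult_carrier_mat zero_carrier_mat)
      (elim conjE, assumption)+
qed

lemma RE'_carrier:
  "RE0' q \<in> carrier_mat (2 ^ q) (2 ^ q) \<and>
   RE1' q \<in> carrier_mat (2 ^ q) (2 ^ q) \<and>
   RE2' q \<in> carrier_mat (2 ^ q) (2 ^ q)"
proof (induction q)
  case 0
  show ?case
    unfolding RE0'.simps RE1'.simps RE2'.simps power_0
    by (intro conjI one_carrier_mat zero_carrier_mat)
next
  case (Suc q)
  then show ?case
    unfolding RE0'.simps RE1'.simps RE2'.simps power_Suc mult_2
    by (intro conjI four_block_carrier_mat add_carrier_mat smult_carrier_mat zero_carrier_mat)
      (elim conjE, assumption)+
qed

end

theory Submission
  imports Defs
begin

text \<open>A Right end is encoded by labelling each square as empty or as one of the four halves of a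
  domino. Being a Right end becomes a condition on pairs of neighbouring labels only, so this is a
  transfer matrix computation. The row transfer matrix is indexed by the sets of columns in which a
  vertical domino crosses the upper, respectively the lower, boundary of the row, and the block
  recursion builds the row column by column, from left to right. The two families of matrices
  differ in whether the last square of the row is empty; their sum disregards this.\<close>

section \<open>The generating polynomial as a sum over Right ends\<close>

text \<open>Compare coefficients: each Right end contributes a monomial with coefficient 1, so the
  coefficient at exponents \<open>a\<close> and \<open>b\<close> counts the Right ends with these
  domino numbers.\<close>

lemma right_end_gf_conv_sum:
  "right_end_gf m n =
     (\<Sum>P | right_end m n P. var_x ^ card {d \<in> P. vertical d} * var_y ^ card {d \<in> P. horizontal d})"
proof (intro poly_eqI)
  fix a b
  let ?v = "\<lambda>P. card {d \<in> P. vertical d}" and ?h = "\<lambda>P. card {d \<in> P. horizontal d}"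
  have "var_x ^ i * var_y ^ j = monom (monom 1 i) j" for i j
    using right_end_gf_summand[of 1 i j] by simp
  then have "coeff (coeff (\<Sum>P | right_end m n P. var_x ^ ?v P * var_y ^ ?h P) b) a =
      (\<Sum>P | right_end m n P. if ?v P = a \<and> ?h P = b then 1 else 0)"
    by (auto simp: coeff_sum intro!: sum.cong)
  also have "\<dots> = (\<Sum>P \<in> {P \<in> {P. right_end m n P}. ?v P = a \<and> ?h P = b}. 1)"
    by (rule sum.inter_filter[symmetric, OF finite_right_ends])
  also have "\<dots> = coeff (coeff (right_end_gf m n) b) a"
    by (simp add: coeff_right_end_gf num_right_ends_def)
  finally show "coeff (coeff (right_end_gf m n) b) a =
      coeff (coeff (\<Sum>P | right_end m n P. var_x ^ ?v P * var_y ^ ?h P) b) a" ..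
qed


section \<open>Labelled grids\<close>

text \<open>The labels stand for an empty square and for the upper, lower, left and right halves of
  dominoes.\<close>

datatype cell = E | U | D | L | R

lemma UNIV_cell: "UNIV = {E, U, D, L, R}"
  using cell.exhaust by auto

lemma finite_UNIV_cell: "finite (UNIV :: cell set)"
  by (simp add: UNIV_cell)

lemma sum_Collect_cell:
  "(\<Sum>d | Q d. f d) = (if Q E then f E else 0) + (if Q U then f U else 0) +
     (if Q D then f D else 0) + (if Q L then f L else 0) + (if Q R then f R else (0 :: int poly poly))"
proof -
  have "(\<Sum>d | Q d. f d) = (\<Sum>d\<in>UNIV. if Q d then f d else 0)"
    using sum.inter_filter[OF finite_UNIV_cell, of f Q] by simp
  then show ?thesis
    by (simp add: UNIV_cell add.assoc)
qed

text \<open>The first conjunct completes every horizontal domino. The second is the Right end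
  condition: two adjacent empty squares would leave room for a further horizontal domino.\<close>

definition fits :: "cell \<Rightarrow> cell \<Rightarrow> bool" where
  "fits c d \<longleftrightarrow> (c = L) = (d = R) \<and> \<not> (c = E \<and> d = E)"

text \<open>Vertically adjacent empty squares are allowed, since Left may still have moves. Equality
  of the mapped lists also forces equal row lengths.\<close>

definition link :: "cell list \<Rightarrow> cell list \<Rightarrow> bool" where
  "link r r' \<longleftrightarrow> map (\<lambda>c. c = U) r = map (\<lambda>c. c = D) r'"

text \<open>Each domino is weighted on one half only, the one at which the block recursion inserts
  \<open>var_x\<close> or \<open>var_y\<close>.\<close>

fun wt :: "cell \<Rightarrow> int poly poly" where
  "wt U = var_x"
| "wt R = var_y"
| "wt _ = 1"

text \<open>Outside the board, a row is bounded by \<^const>\<open>U\<close> rather than \<^const>\<open>E\<close>: an empty square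
  may touch the border.\<close>

definition row :: "cell \<Rightarrow> cell list \<Rightarrow> bool" where
  "row c w \<longleftrightarrow> successively fits (c # w @ [U])"

text \<open>\<open>r\<close> is the row above the grid, so that rows can be peeled off from the top.
  The appended row of \<open>E\<close> forbids upper halves just above it and, through
  \<open>link\<close>, fixes the row length.\<close>

definition grids :: "nat \<Rightarrow> nat \<Rightarrow> cell list \<Rightarrow> cell list list set" where
  "grids n k r = {g. length g = k \<and> (\<forall>w\<in>set g. row U w) \<and>
     successively link (r # g @ [replicate n E])}"

lemma row_Nil: "row c [] \<longleftrightarrow> fits c U"
  by (simp add: row_def)

lemma row_Cons: "row c (d # w) \<longleftrightarrow> fits c d \<and> row d w"
  by (simp add: row_def)

lemma length_link: "link r r' \<Longrightarrow> length r' = length r"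
  unfolding link_def by (metis length_map)

lemma grids_0: "grids n 0 r = (if map (\<lambda>c. c = U) r = replicate n False then {[]} else {})"
  by (auto simp: grids_def link_def)

lemma grids_Suc:
  "grids n (Suc k) r = (\<Union>w \<in> {w. row U w \<and> link r w}. (#) w ` grids n k w)"
  by (auto simp: grids_def length_Suc_conv)

lemma finite_words: "finite {w :: cell list. length w = k}"
  using finite_lists_length_eq[OF finite_UNIV_cell] by simp

lemma finite_rows: "finite {w. row c w \<and> link r w}"
  by (rule finite_subset[OF _ finite_words[of "length r"]]) (auto dest: length_link)

lemma finite_grids: "finite (grids n k r)"
  by (induction k arbitrary: r) (auto simp: grids_0 grids_Suc finite_rows)


section \<open>The matrix entries\<close>

text \<open>Binary value with the first column as most significant bit: this bit selects the block
  of \<open>four_block_mat\<close>, which splits off the first square of the row.\<close>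

fun code :: "bool list \<Rightarrow> nat" where
  "code [] = 0"
| "code (b # bs) = (if b then 2 ^ length bs else 0) + code bs"

lemma code_less: "code bs < 2 ^ length bs"
  by (induction bs) auto

lemma code_replicate_False: "code (replicate n False) = 0"
  by (induction n) auto

text \<open>By \<open>code_less\<close> the tails contribute less than the leading power of two, so
  the leading bits agree.\<close>

lemma code_inject: "length bs = length cs \<Longrightarrow> code bs = code cs \<Longrightarrow> bs = cs"
proof (induction bs cs rule: list_induct2)
  case (Cons b bs c cs)
  then show ?case
    using code_less[of bs] code_less[of cs] by (auto split: if_splits)
qed simp

lemma code_bij: "bij_betw code {bs. length bs = n} {0..<2 ^ n}"
proof -
  have inj: "inj_on code {bs. length bs = n}"
    by (auto intro!: inj_onI code_inject)
  have "card {bs :: bool list. length bs = n} = 2 ^ n"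
    using card_lists_length_eq[of "UNIV :: bool set" n] by (simp add: card_UNIV_bool)
  then have "code ` {bs. length bs = n} = {0..<2 ^ n}"
    by (intro card_subset_eq) (auto simp: card_image[OF inj] code_less)
  with inj show ?thesis
    by (simp add: bij_betw_def)
qed

text \<open>The index of a matrix of the recursion records the square preceding the current one:
  1 if it is empty, 2 if a horizontal domino starts there, 0 otherwise.\<close>

fun RE :: "cell \<Rightarrow> nat \<Rightarrow> int poly poly mat" where
  "RE E q = RE1 q + RE1' q"
| "RE L q = RE2 q + RE2' q"
| "RE _ q = RE0 q + RE0' q"

text \<open>At the right border only an unfinished horizontal domino is forbidden. The value 1 after
  an empty square comes from \<open>RE1'\<close>, after \<open>U\<close>, \<open>D\<close> or
  \<open>R\<close> from \<open>RE0\<close>.\<close>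

lemma RE_entry_Nil: "RE c 0 $$ (0, 0) = (if fits c U then 1 else 0)"
  by (cases c) (simp_all add: fits_def)

text \<open>One step of the block recursion adds one square: \<open>a\<close> and \<open>b\<close>
  pick the block, \<open>c\<close> picks the matrix. The zero block at \<open>a = b = True\<close>
  reflects that no square is both a lower and an upper half.\<close>

lemma RE_entry_Cons:
  assumes "length s = q" "length t = q"
  shows "RE c (Suc q) $$ (code (a # s), code (b # t)) =
    (\<Sum>d | fits c d \<and> (d = D) = a \<and> (d = U) = b. wt d * RE d q $$ (code s, code t))"
proof -
  have "code s < 2 ^ q" "code t < 2 ^ q"
    using code_less assms by metis+
  then show ?thesis
    using RE_carrier[of q] RE'_carrier[of q] assms unfolding sum_Collect_cell
    by (cases c; cases a; cases b) (auto simp: fits_def algebra_simps)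
qed

text \<open>Unfolding \<open>RE_entry_Cons\<close> column by column turns the entry into a sum over
  row words; \<open>s\<close> and \<open>t\<close> prescribe the crossings of the upper and the
  lower boundary.\<close>

lemma RE_entry:
  "length s = length t \<Longrightarrow> RE c (length s) $$ (code s, code t) =
     (\<Sum>w | row c w \<and> map (\<lambda>d. d = D) w = s \<and> map (\<lambda>d. d = U) w = t. prod_list (map wt w))"
proof (induction s t arbitrary: c rule: list_induct2)
  case Nil
  have "{w. row c w \<and> w = []} = (if fits c U then {[]} else {})"
    by (auto simp: row_Nil)
  then show ?case
    by (simp add: RE_entry_Nil)
next
  case (Cons a s b t)
  let ?W = "\<lambda>c s t. {w. row c w \<and> map (\<lambda>d. d = D) w = s \<and> map (\<lambda>d. d = U) w = t}"
  let ?C = "{d. fits c d \<and> (d = D) = a \<and> (d = U) = b}"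
  have fin: "finite (?W d s t)" for d
    by (rule finite_subset[OF _ finite_words[of "length s"]]) auto
  have finC: "finite ?C"
    by (rule finite_subset[OF _ finite_UNIV_cell]) simp
  have "?W c (a # s) (b # t) = (\<Union>d\<in>?C. (#) d ` ?W d s t)"
    by (auto simp: row_Cons map_eq_Cons_conv)
  then have "(\<Sum>w\<in>?W c (a # s) (b # t). prod_list (map wt w)) =
      (\<Sum>d\<in>?C. \<Sum>w\<in>(#) d ` ?W d s t. prod_list (map wt w))"
    using fin finC by (simp only:) (subst sum.UNION_disjoint, auto)
  also have "\<dots> = (\<Sum>d\<in>?C. wt d * (\<Sum>w\<in>?W d s t. prod_list (map wt w)))"
    by (simp add: sum.reindex sum_distrib_left)
  also have "\<dots> = RE c (Suc (length s)) $$ (code (a # s), code (b # t))"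
    using Cons by (simp add: RE_entry_Cons del: code.simps)
  finally show ?case
    by simp
qed

section \<open>Powers of the transfer matrix as sums over grids\<close>

lemma pow_mat_Suc_left:
  assumes "(A :: 'a :: semiring_1 mat) \<in> carrier_mat k k"
  shows "A ^\<^sub>m Suc l = A * A ^\<^sub>m l"
proof (induction l)
  case 0
  then show ?case
    using assms by simp
next
  case (Suc l)
  then show ?case
    using assms assoc_mult_mat[OF assms pow_carrier_mat[OF assms] assms] by simp
qed

lemma mult_mat_entry:
  assumes "A \<in> carrier_mat k k" "B \<in> carrier_mat k k" "i < k" "j < k"
  shows "(A * B) $$ (i, j) = (\<Sum>l\<in>{0..<k}. A $$ (i, l) * B $$ (l, j))"
  using assms by (simp add: scalar_prod_def)

definition grid_wt :: "cell list list \<Rightarrow> int poly poly" where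
  "grid_wt g = prod_list (map (\<lambda>w. prod_list (map wt w)) g)"

text \<open>The first factor accounts for the top row, the others for the grid below it. Column
  index 0 means that no domino crosses the bottom boundary; for \<open>k = 0\<close> the identity
  matrix gives 1 exactly if \<open>r\<close> has no upper half.\<close>

lemma RE_pow_entry:
  "length r = n \<Longrightarrow>
     ((RE0 n + RE0' n) ^\<^sub>m k) $$ (code (map (\<lambda>c. c = U) r), 0) = (\<Sum>g\<in>grids n k r. grid_wt g)"
proof (induction k arbitrary: r)
  case 0
  have "code (map (\<lambda>c. c = U) r) < 2 ^ n"
    using code_less[of "map (\<lambda>c. c = U) r"] 0 by simp
  moreover have "code (map (\<lambda>c. c = U) r) = 0 \<longleftrightarrow> map (\<lambda>c. c = U) r = replicate n False"
    using code_inject[of "map (\<lambda>c. c = U) r" "replicate n False"] 0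
    by (auto simp: code_replicate_False)
  ultimately show ?case
    using carrier_matD[OF conjunct1[OF RE'_carrier[of n]]] by (simp add: grids_0 grid_wt_def)
next
  case (Suc k)
  let ?A = "RE0 n + RE0' n"
  let ?s = "map (\<lambda>c. c = U) r"
  let ?W = "{w. row U w \<and> link r w}"
  let ?M = "{t :: bool list. length t = n}"
  let ?f = "\<lambda>w. prod_list (map wt w) * (\<Sum>g\<in>grids n k w. grid_wt g)"
  have A: "?A \<in> carrier_mat (2 ^ n) (2 ^ n)"
    using RE_carrier[of n] RE'_carrier[of n] by simp
  have s: "code ?s < 2 ^ n"
    using code_less[of ?s] Suc.prems by simp
  have finM: "finite ?M"
    using finite_lists_length_eq[of "UNIV :: bool set" n] by simp
  \<comment> \<open>\<open>link r w\<close> makes \<open>?s\<close> the pattern of lower halves of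
    \<open>w\<close>. The induction hypothesis for the rows below depends on \<open>w\<close> only
    through its pattern \<open>t\<close> of upper halves.\<close>
  have entry: "?A $$ (code ?s, code t) * (?A ^\<^sub>m k) $$ (code t, 0) =
      (\<Sum>w | w \<in> ?W \<and> map (\<lambda>d. d = U) w = t. ?f w)" if "t \<in> ?M" for t
  proof -
    have "?A $$ (code ?s, code t) = (\<Sum>w | w \<in> ?W \<and> map (\<lambda>d. d = U) w = t. prod_list (map wt w))"
      using RE_entry[of ?s t U] that Suc.prems by (simp add: link_def conj_ac eq_commute)
    moreover have "(\<Sum>g\<in>grids n k w. grid_wt g) = (?A ^\<^sub>m k) $$ (code t, 0)"
      if "w \<in> ?W \<and> map (\<lambda>d. d = U) w = t" for w
      using Suc.IH[of w] Suc.prems that by (auto dest: length_link)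
    ultimately show ?thesis
      by (simp add: sum_distrib_right)
  qed
  \<comment> \<open>Taking a factor off on the left matches \<open>grids_Suc\<close>, which removes
    the top row.\<close>
  have "(?A ^\<^sub>m Suc k) $$ (code ?s, 0) =
      (\<Sum>i\<in>{0..<2 ^ n}. ?A $$ (code ?s, i) * (?A ^\<^sub>m k) $$ (i, 0))"
    unfolding pow_mat_Suc_left[OF A]
    using mult_mat_entry[OF A pow_carrier_mat[OF A] s] by simp
  also have "\<dots> = (\<Sum>t\<in>?M. ?A $$ (code ?s, code t) * (?A ^\<^sub>m k) $$ (code t, 0))"
    by (rule sum.reindex_bij_betw[OF code_bij, symmetric])
  also have "\<dots> = (\<Sum>t\<in>?M. \<Sum>w | w \<in> ?W \<and> map (\<lambda>d. d = U) w = t. ?f w)"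
    by (rule sum.cong[OF refl entry])
  \<comment> \<open>Every row \<open>w\<close> has exactly one pattern \<open>t\<close>, so the
    double sum collapses.\<close>
  also have "\<dots> = (\<Sum>w\<in>?W. ?f w)"
    using Suc.prems by (intro sum.group finite_rows finM) (auto dest: length_link)
  also have "\<dots> = (\<Sum>w\<in>?W. \<Sum>g\<in>(#) w ` grids n k w. grid_wt g)"
    by (simp add: sum.reindex sum_distrib_left grid_wt_def)
  also have "\<dots> = (\<Sum>g\<in>grids n (Suc k) r. grid_wt g)"
    unfolding grids_Suc by (rule sum.UNION_disjoint[symmetric]) (auto simp: finite_rows finite_grids)
  finally show ?case .
qed

section \<open>Grids and Right ends\<close>

definition vert :: "nat \<Rightarrow> nat \<Rightarrow> square set" where
  "vert i j = {(i, j), (Suc i, j)}"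

definition hor :: "nat \<Rightarrow> nat \<Rightarrow> square set" where
  "hor i j = {(i, j), (i, Suc j)}"

lemma vertical_iff: "vertical d \<longleftrightarrow> (\<exists>i j. d = vert i j)"
  by (simp add: vertical_def vert_def)

lemma horizontal_iff: "horizontal d \<longleftrightarrow> (\<exists>i j. d = hor i j)"
  by (simp add: horizontal_def hor_def)

lemma vert_eq_iff [simp]: "vert i j = vert i' j' \<longleftrightarrow> i = i' \<and> j = j'"
  by (auto simp: vert_def doubleton_eq_iff)

lemma hor_eq_iff [simp]: "hor i j = hor i' j' \<longleftrightarrow> i = i' \<and> j = j'"
  by (auto simp: hor_def doubleton_eq_iff)

lemma vert_neq_hor [simp]: "vert i j \<noteq> hor i' j'" "hor i' j' \<noteq> vert i j"
  by (auto simp: vert_def hor_def doubleton_eq_iff)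

text \<open>The grid conditions for labels given by coordinates; the first two conjuncts are the
  border conditions that \<open>row\<close> and \<open>grids\<close> express by bounding
  labels.\<close>

definition tiling :: "nat \<Rightarrow> nat \<Rightarrow> (nat \<Rightarrow> nat \<Rightarrow> cell) \<Rightarrow> bool" where
  "tiling m n f \<longleftrightarrow>
     (\<forall>i<m. f i 0 \<noteq> R \<and> f i (n - 1) \<noteq> L) \<and> (\<forall>j<n. f 0 j \<noteq> D \<and> f (m - 1) j \<noteq> U) \<and>
     (\<forall>i<m. \<forall>j. Suc j < n \<longrightarrow> fits (f i j) (f i (Suc j))) \<and>
     (\<forall>i j. Suc i < m \<longrightarrow> j < n \<longrightarrow> (f i j = U) = (f (Suc i) j = D))"

lemma successively_conv_nth:
  "successively Q xs \<longleftrightarrow> (\<forall>i. Suc i < length xs \<longrightarrow> Q (xs ! i) (xs ! Suc i))"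
proof (induction xs)
  case (Cons x xs)
  then show ?case
    by (cases xs) (auto simp: nth_Cons split: nat.split)
qed simp

lemma successively_bounded_conv_nth:
  assumes "xs \<noteq> []"
  shows "successively Q (a # xs @ [b]) \<longleftrightarrow> Q a (xs ! 0) \<and> Q (xs ! (length xs - 1)) b \<and>
    (\<forall>i. Suc i < length xs \<longrightarrow> Q (xs ! i) (xs ! Suc i))"
  using assms successively_conv_nth[of Q xs]
  by (auto simp: successively_Cons successively_append_iff hd_conv_nth last_conv_nth nth_append)

lemma link_conv_nth:
  "link r r' \<longleftrightarrow> length r = length r' \<and> (\<forall>j<length r'. (r ! j = U) = (r' ! j = D))"
  by (auto simp: link_def list_eq_iff_nth_eq)

lemma grids_conv_tiling:
  assumes "m > 0" "n > 0"
  shows "g \<in> grids n m (replicate n E) \<longleftrightarrow>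
    length g = m \<and> (\<forall>i<m. length (g ! i) = n) \<and> tiling m n (\<lambda>i j. g ! i ! j)"
proof -
  \<comment> \<open>Row lengths are inherited from the bounding row above and passed downwards by
    \<open>link\<close>.\<close>
  have len: "length (g ! i) = n"
    if "length g = m" "successively link (replicate n E # g @ [replicate n E])" "i < m" for i
  proof -
    have "g \<noteq> []"
      using that(1) assms(1) by auto
    note links = that(2)[unfolded successively_bounded_conv_nth[OF \<open>g \<noteq> []\<close>] that(1)]
    show ?thesis
      using that(3)
    proof (induction i)
      case 0
      then show ?case
        using links by (auto dest: length_link)
    next
      case (Suc i)
      then show ?case
        using links length_link[of "g ! i" "g ! Suc i"] by auto
    qed
  qed
  show ?thesis
  proof (cases "length g = m \<and> (\<forall>i<m. length (g ! i) = n)")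
    case True
    then have "g \<noteq> []" and rows: "\<And>i. i < m \<Longrightarrow> g ! i \<noteq> [] \<and> length (g ! i) = n"
      using assms by fastforce+
    \<comment> \<open>Next to the bounding label \<open>U\<close>, \<open>fits\<close> forbids only
      \<open>R\<close> at the left border and \<open>L\<close> at the right one.\<close>
    have "row U (g ! i) \<longleftrightarrow> g ! i ! 0 \<noteq> R \<and> g ! i ! (n - 1) \<noteq> L \<and>
        (\<forall>j. Suc j < n \<longrightarrow> fits (g ! i ! j) (g ! i ! Suc j))" if "i < m" for i
      unfolding row_def using rows[OF that]
      by (subst successively_bounded_conv_nth) (auto simp: fits_def)
    then have "(\<forall>w\<in>set g. row U w) \<longleftrightarrow> (\<forall>i<m. g ! i ! 0 \<noteq> R \<and> g ! i ! (n - 1) \<noteq> L) \<and>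
        (\<forall>i<m. \<forall>j. Suc j < n \<longrightarrow> fits (g ! i ! j) (g ! i ! Suc j))"
      using True by (auto simp: all_set_conv_all_nth)
    moreover have "successively link (replicate n E # g @ [replicate n E]) \<longleftrightarrow>
        (\<forall>j<n. g ! 0 ! j \<noteq> D \<and> g ! (m - 1) ! j \<noteq> U) \<and>
        (\<forall>i j. Suc i < m \<longrightarrow> j < n \<longrightarrow> (g ! i ! j = U) = (g ! Suc i ! j = D))"
      using \<open>g \<noteq> []\<close> True assms
      by (subst successively_bounded_conv_nth) (auto simp: link_conv_nth)
    ultimately show ?thesis
      unfolding grids_def tiling_def using True by auto
  next
    case False
    then show ?thesis
      using len by (auto simp: grids_def)
  qed
qed

section \<open>Labels of a given position\<close>

definition label :: "square set set \<Rightarrow> nat \<Rightarrow> nat \<Rightarrow> cell" where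
  "label P i j =
     (if vert i j \<in> P then U else if \<exists>k. i = Suc k \<and> vert k j \<in> P then D
      else if hor i j \<in> P then L else if \<exists>k. j = Suc k \<and> hor i k \<in> P then R else E)"

definition dominoes :: "nat \<Rightarrow> nat \<Rightarrow> (nat \<Rightarrow> nat \<Rightarrow> cell) \<Rightarrow> square set set" where
  "dominoes m n f = {vert i j | i j. i < m \<and> j < n \<and> f i j = U} \<union>
     {hor i j | i j. i < m \<and> j < n \<and> f i j = L}"

lemma vert_in_dominoes: "vert i j \<in> dominoes m n f \<longleftrightarrow> i < m \<and> j < n \<and> f i j = U"
  by (auto simp: dominoes_def)

lemma hor_in_dominoes: "hor i j \<in> dominoes m n f \<longleftrightarrow> i < m \<and> j < n \<and> f i j = L"
  by (auto simp: dominoes_def)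

lemma position_dominoE:
  assumes "position m n P" "d \<in> P"
  obtains i j where "d = vert i j" "Suc i < m" "j < n" | i j where "d = hor i j" "i < m" "Suc j < n"
  using assms unfolding position_def vertical_iff horizontal_iff
  by (force simp: board_def vert_def hor_def)

lemma position_unique:
  assumes "position m n P" "d \<in> P" "e \<in> P" "p \<in> d" "p \<in> e"
  shows "d = e"
  using assms unfolding position_def by blast

text \<open>Dominoes of a position that share a square coincide, so the tests in
  \<open>label\<close> exclude each other and each decides its label by itself.\<close>

lemma label_iff:
  assumes "position m n P"
  shows "label P i j = U \<longleftrightarrow> vert i j \<in> P"
    and "label P i j = D \<longleftrightarrow> (\<exists>k. i = Suc k \<and> vert k j \<in> P)"
    and "label P i j = L \<longleftrightarrow> hor i j \<in> P"
    and "label P i j = R \<longleftrightarrow> (\<exists>k. j = Suc k \<and> hor i k \<in> P)"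
proof -
  have mem: "(i, j) \<in> vert i j" "(Suc i, j) \<in> vert i j" "(i, j) \<in> hor i j" "(i, Suc j) \<in> hor i j" for i j
    by (simp_all add: vert_def hor_def)
  note unique = position_unique[OF assms]
  \<comment> \<open>One exclusion for each of the six pairs among the four dominoes that could cover
    a square.\<close>
  have "\<not> (vert (Suc k) j \<in> P \<and> vert k j \<in> P)" for k
    using unique[of "vert (Suc k) j" "vert k j" "(Suc k, j)"] mem by auto
  moreover have "\<not> (vert i j \<in> P \<and> hor i j \<in> P)"
    using unique[of "vert i j" "hor i j" "(i, j)"] mem by auto
  moreover have "\<not> (vert i (Suc k) \<in> P \<and> hor i k \<in> P)" for k
    using unique[of "vert i (Suc k)" "hor i k" "(i, Suc k)"] mem by auto
  moreover have "\<not> (vert k j \<in> P \<and> hor (Suc k) j \<in> P)" for k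
    using unique[of "vert k j" "hor (Suc k) j" "(Suc k, j)"] mem by auto
  moreover have "\<not> (vert k (Suc l) \<in> P \<and> hor (Suc k) l \<in> P)" for k l
    using unique[of "vert k (Suc l)" "hor (Suc k) l" "(Suc k, Suc l)"] mem by auto
  moreover have "\<not> (hor i (Suc k) \<in> P \<and> hor i k \<in> P)" for k
    using unique[of "hor i (Suc k)" "hor i k" "(i, Suc k)"] mem by auto
  ultimately show "label P i j = U \<longleftrightarrow> vert i j \<in> P"
    and "label P i j = D \<longleftrightarrow> (\<exists>k. i = Suc k \<and> vert k j \<in> P)"
    and "label P i j = L \<longleftrightarrow> hor i j \<in> P"
    and "label P i j = R \<longleftrightarrow> (\<exists>k. j = Suc k \<and> hor i k \<in> P)"
    unfolding label_def by auto
qed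

lemma label_E_iff:
  assumes "position m n P"
  shows "label P i j = E \<longleftrightarrow> (i, j) \<notin> \<Union>P"
proof
  assume E: "label P i j = E"
  show "(i, j) \<notin> \<Union>P"
  proof
    assume "(i, j) \<in> \<Union>P"
    then obtain d where d: "d \<in> P" "(i, j) \<in> d"
      by blast
    from assms d(1) show False
      by (rule position_dominoE) (use d E label_iff[OF assms, of i j] in \<open>auto simp: vert_def hor_def\<close>)
  qed
next
  assume "(i, j) \<notin> \<Union>P"
  then show "label P i j = E"
    by (auto simp: label_def vert_def hor_def)
qed

text \<open>Dominoes stay on the board, which gives the border conditions, and two adjacent labels
  \<open>E\<close> in a row would be a move for Right. The rest is \<open>label_iff\<close>.\<close>

lemma tiling_label:
  assumes "right_end m n P" "m > 0" "n > 0"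
  shows "tiling m n (label P)"
proof -
  have pos: "position m n P"
    using assms by (simp add: right_end_def)
  have vert: "Suc i < m \<and> j < n" if "vert i j \<in> P" for i j
    using pos that by (rule position_dominoE) auto
  have hor: "i < m \<and> Suc j < n" if "hor i j \<in> P" for i j
    using pos that by (rule position_dominoE) auto
  have "\<not> (label P i j = E \<and> label P i (Suc j) = E)" if "i < m" "Suc j < n" for i j
  proof
    assume "label P i j = E \<and> label P i (Suc j) = E"
    then have "hor i j \<inter> \<Union>P = {}" "hor i j \<subseteq> board m n" "horizontal (hor i j)"
      using that by (auto simp: label_E_iff[OF pos] hor_def horizontal_def board_def)
    with assms(1) show False
      by (auto simp: right_end_def)
  qed
  then show ?thesis
    using assms(2,3) by (auto simp: tiling_def fits_def label_iff[OF pos] dest: vert hor)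
qed

lemma dominoes_label:
  assumes "position m n P"
  shows "dominoes m n (label P) = P"
proof
  show "dominoes m n (label P) \<subseteq> P"
    by (auto simp: dominoes_def label_iff[OF assms])
  show "P \<subseteq> dominoes m n (label P)"
  proof
    fix d assume d: "d \<in> P"
    with assms show "d \<in> dominoes m n (label P)"
      by (rule position_dominoE)
        (use d in \<open>auto simp: vert_in_dominoes hor_in_dominoes label_iff[OF assms]\<close>)
  qed
qed

section \<open>Right ends read off from labellings\<close>

lemma tiling_iff:
  assumes "tiling m n f" "i < m" "j < n"
  shows "f i j = D \<longleftrightarrow> (\<exists>k. i = Suc k \<and> f k j = U)"
    and "f i j = R \<longleftrightarrow> (\<exists>k. j = Suc k \<and> f i k = L)"
proof -
  \<comment> \<open>Index 0 falls under the border conditions, a positive index under the neighbour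
    conditions.\<close>
  have "i = 0 \<Longrightarrow> f i j \<noteq> D" "\<And>k. i = Suc k \<Longrightarrow> (f k j = U) = (f i j = D)"
    and "j = 0 \<Longrightarrow> f i j \<noteq> R" "\<And>k. j = Suc k \<Longrightarrow> (f i k = L) = (f i j = R)"
    using assms unfolding tiling_def fits_def by blast+
  then show "f i j = D \<longleftrightarrow> (\<exists>k. i = Suc k \<and> f k j = U)"
    and "f i j = R \<longleftrightarrow> (\<exists>k. j = Suc k \<and> f i k = L)"
    by (metis not0_implies_Suc)+
qed

text \<open>The border conditions at \<open>m - 1\<close> and \<open>n - 1\<close> keep the second
  half on the board; the neighbour conditions then give its label.\<close>

lemma tilingD:
  assumes "tiling m n f" "i < m" "j < n"
  shows "f i j = U \<Longrightarrow> Suc i < m \<and> f (Suc i) j = D"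
    and "f i j = L \<Longrightarrow> Suc j < n \<and> f i (Suc j) = R"
proof -
  have "f (m - 1) j \<noteq> U" "f i (n - 1) \<noteq> L"
    using assms by (simp_all add: tiling_def)
  then have "f i j = U \<Longrightarrow> Suc i < m" "f i j = L \<Longrightarrow> Suc j < n"
    using assms(2,3) by (metis Suc_lessI diff_Suc_1)+
  then show "f i j = U \<Longrightarrow> Suc i < m \<and> f (Suc i) j = D"
    and "f i j = L \<Longrightarrow> Suc j < n \<and> f i (Suc j) = R"
    using tiling_iff[OF assms(1)] assms(2,3) by blast+
qed

text \<open>The domino that a label claims for its square. On the board, a tiling has
  \<open>D\<close> only in positive rows and \<open>R\<close> only in positive columns, so
  \<open>i - 1\<close> and \<open>j - 1\<close> are not truncated there.\<close>

fun domino_at :: "(nat \<Rightarrow> nat \<Rightarrow> cell) \<Rightarrow> square \<Rightarrow> square set" where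
  "domino_at f (i, j) = (case f i j of U \<Rightarrow> vert i j | D \<Rightarrow> vert (i - 1) j | L \<Rightarrow> hor i j
     | R \<Rightarrow> hor i (j - 1) | E \<Rightarrow> {})"

text \<open>Since the domino is a function of the square, distinct dominoes are disjoint.\<close>

lemma domino_at_eq:
  assumes "tiling m n f" "d \<in> dominoes m n f" "p \<in> d"
  shows "domino_at f p = d"
  using assms(2,3) tilingD[OF assms(1)]
  by (auto simp: dominoes_def vert_def hor_def)

lemma domino_at_in_dominoes:
  assumes "tiling m n f" "i < m" "j < n" "f i j \<noteq> E"
  shows "(i, j) \<in> domino_at f (i, j) \<and> domino_at f (i, j) \<in> dominoes m n f"
  using tiling_iff[OF assms(1-3)] assms(2-4)
  by (cases "f i j") (auto simp: vert_in_dominoes hor_in_dominoes, auto simp: vert_def hor_def)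

lemma right_end_dominoes:
  assumes "tiling m n f"
  shows "right_end m n (dominoes m n f)"
proof -
  have "d \<subseteq> board m n \<and> (vertical d \<or> horizontal d)" if "d \<in> dominoes m n f" for d
    using that tilingD[OF assms]
    by (auto simp: dominoes_def vertical_iff horizontal_iff) (auto simp: board_def vert_def hor_def)
  moreover have "d \<inter> e = {}" if "d \<in> dominoes m n f" "e \<in> dominoes m n f" "d \<noteq> e" for d e
    using that domino_at_eq[OF assms] by blast
  moreover have False if d: "horizontal d" "d \<subseteq> board m n" "d \<inter> \<Union>(dominoes m n f) = {}" for d
  proof -
    obtain i j where ij: "d = {(i, j), (i, Suc j)}"
      using d(1) by (auto simp: horizontal_def)
    then have "i < m" "Suc j < n"
      using d(2) by (auto simp: board_def)
    then have "f i j \<noteq> E \<or> f i (Suc j) \<noteq> E"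
      using assms by (auto simp: tiling_def fits_def)
    then show False
      using d(3) ij domino_at_in_dominoes[OF assms \<open>i < m\<close>, of j]
        domino_at_in_dominoes[OF assms \<open>i < m\<close>, of "Suc j"] \<open>Suc j < n\<close> by auto
  qed
  ultimately show ?thesis
    unfolding right_end_def position_def by blast
qed

text \<open>On a tiling the tests in \<open>label\<close> become the equations of
  \<open>f i j\<close> with \<open>U\<close>, \<open>D\<close>, \<open>L\<close> and
  \<open>R\<close>, of which at most one holds.\<close>

lemma label_dominoes:
  assumes "tiling m n f" "i < m" "j < n"
  shows "label (dominoes m n f) i j = f i j"
proof -
  let ?P = "dominoes m n f"
  have "vert i j \<in> ?P \<longleftrightarrow> f i j = U"
    using assms by (simp add: vert_in_dominoes)
  moreover have "(\<exists>k. i = Suc k \<and> vert k j \<in> ?P) \<longleftrightarrow> f i j = D"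
    using tiling_iff(1)[OF assms] assms(2,3) by (auto simp: vert_in_dominoes)
  moreover have "hor i j \<in> ?P \<longleftrightarrow> f i j = L"
    using assms by (simp add: hor_in_dominoes)
  moreover have "(\<exists>k. j = Suc k \<and> hor i k \<in> ?P) \<longleftrightarrow> f i j = R"
    using tiling_iff(2)[OF assms] assms(2,3) by (auto simp: hor_in_dominoes)
  ultimately show ?thesis
    unfolding label_def by (cases "f i j") simp_all
qed

section \<open>Weights and domino counts\<close>

lemma prod_wt:
  assumes "finite A"
  shows "(\<Prod>p\<in>A. wt (h p)) = var_x ^ card {p \<in> A. h p = U} * var_y ^ card {p \<in> A. h p = R}"
proof -
  have "wt c = (if c = U then var_x else 1) * (if c = R then var_y else 1)" for c
    by (cases c) simp_all
  then show ?thesis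
    using assms by (simp add: prod.distrib prod.inter_filter[symmetric])
qed

lemma grid_wt_conv_prod:
  assumes "length g = m" "\<And>i. i < m \<Longrightarrow> length (g ! i) = n"
  shows "grid_wt g = (\<Prod>(i, j)\<in>board m n. wt (g ! i ! j))"
proof -
  have nth: "prod_list (map h xs) = (\<Prod>i\<in>{0..<length xs}. h (xs ! i))"
    for h :: "'b \<Rightarrow> int poly poly" and xs
    by (simp add: prod.list_conv_set_nth)
  show ?thesis
    using assms by (simp add: grid_wt_def nth board_def prod.cartesian_product[symmetric])
qed

text \<open>A vertical domino corresponds to its upper square.\<close>

lemma card_vertical:
  assumes "position m n P"
  shows "card {d \<in> P. vertical d} = card {p \<in> board m n. label P (fst p) (snd p) = U}"
proof (rule bij_betw_same_card[symmetric])
  show "bij_betw (\<lambda>(i, j). vert i j) {p \<in> board m n. label P (fst p) (snd p) = U} {d \<in> P. vertical d}"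
    unfolding bij_betw_def
  proof
    show "inj_on (\<lambda>(i, j). vert i j) {p \<in> board m n. label P (fst p) (snd p) = U}"
      by (auto intro!: inj_onI)
    have "i < m \<and> j < n" if "vert i j \<in> P" for i j
      using assms that by (rule position_dominoE) auto
    then show "(\<lambda>(i, j). vert i j) ` {p \<in> board m n. label P (fst p) (snd p) = U} = {d \<in> P. vertical d}"
      by (force simp: label_iff[OF assms] vertical_iff board_def)
  qed
qed

text \<open>Horizontal dominoes are counted by their right halves since \<^const>\<open>RE2\<close> puts the factor y
  there.\<close>

lemma card_horizontal:
  assumes "position m n P"
  shows "card {d \<in> P. horizontal d} = card {p \<in> board m n. label P (fst p) (snd p) = R}"
proof (rule bij_betw_same_card[symmetric])
  let ?A = "{p \<in> board m n. label P (fst p) (snd p) = R}"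
  have bound: "i < m \<and> Suc j < n" if "hor i j \<in> P" for i j
    using assms that by (rule position_dominoE) auto
  show "bij_betw (\<lambda>(i, j). hor i (j - 1)) ?A {d \<in> P. horizontal d}"
    unfolding bij_betw_def
  proof
    \<comment> \<open>By \<open>label_iff\<close>, \<open>j\<close> is a successor on
      \<open>?A\<close>, so \<open>j - 1\<close> loses no information.\<close>
    show "inj_on (\<lambda>(i, j). hor i (j - 1)) ?A"
      by (auto intro!: inj_onI simp: label_iff[OF assms])
    have "hor i j \<in> (\<lambda>(i, j). hor i (j - 1)) ` ?A" if "hor i j \<in> P" for i j
      using bound[OF that] that
      by (auto simp: label_iff[OF assms] board_def intro!: image_eqI[where x = "(i, Suc j)"])
    then show "(\<lambda>(i, j). hor i (j - 1)) ` ?A = {d \<in> P. horizontal d}"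
      by (auto simp: label_iff[OF assms] horizontal_iff)
  qed
qed

section \<open>The bijection between Right ends and grids\<close>

lemma tiling_cong:
  assumes "\<And>i j. i < m \<Longrightarrow> j < n \<Longrightarrow> f i j = f' i j" "m > 0" "n > 0"
  shows "tiling m n f \<longleftrightarrow> tiling m n f'"
  using assms by (simp add: tiling_def)

lemma dominoes_cong:
  assumes "\<And>i j. i < m \<Longrightarrow> j < n \<Longrightarrow> f i j = f' i j"
  shows "dominoes m n f = dominoes m n f'"
  using assms by (auto simp: dominoes_def)

theorem theorem11:
  fixes m n :: nat
  assumes "m > 0" and "n > 0"
  shows "right_end_gf m n = ((RE0 n + RE0' n) ^\<^sub>m m) $$ (0, 0)"
proof -
  let ?G = "grids n m (replicate n E)"
  let ?tab = "\<lambda>P. map (\<lambda>i. map (label P i) [0..<n]) [0..<m]"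
  let ?doms = "\<lambda>g. dominoes m n (\<lambda>i j. g ! i ! j)"
  have "right_end_gf m n = (\<Sum>g\<in>?G. grid_wt g)"
    unfolding right_end_gf_conv_sum
  proof (rule sum.reindex_bij_witness[of _ ?doms ?tab])
    fix P assume "P \<in> {P. right_end m n P}"
    then have re: "right_end m n P" and pos: "position m n P"
      by (simp_all add: right_end_def)
    \<comment> \<open>\<open>?tab P\<close> tabulates \<open>label P\<close> on the board, and
      \<open>dominoes\<close> reads no other values.\<close>
    have "?doms (?tab P) = dominoes m n (label P)"
      by (rule dominoes_cong) simp
    then show "?doms (?tab P) = P"
      by (simp add: dominoes_label[OF pos])
    have "tiling m n (\<lambda>i j. ?tab P ! i ! j) \<longleftrightarrow> tiling m n (label P)"
      by (rule tiling_cong) (simp_all add: assms)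
    then show "?tab P \<in> ?G"
      using tiling_label[OF re assms] by (simp add: grids_conv_tiling assms)
    have "grid_wt (?tab P) = (\<Prod>p\<in>board m n. wt (label P (fst p) (snd p)))"
      by (subst grid_wt_conv_prod[of _ m n]) (auto simp: board_def intro!: prod.cong)
    then show "grid_wt (?tab P) = var_x ^ card {d \<in> P. vertical d} * var_y ^ card {d \<in> P. horizontal d}"
      by (subst (asm) prod_wt) (simp_all add: board_def card_vertical[OF pos] card_horizontal[OF pos])
  next
    fix g assume "g \<in> ?G"
    then have g: "length g = m" "\<And>i. i < m \<Longrightarrow> length (g ! i) = n" "tiling m n (\<lambda>i j. g ! i ! j)"
      using assms by (simp_all add: grids_conv_tiling)
    show "?doms g \<in> {P. right_end m n P}"
      using right_end_dominoes[OF g(3)] by simp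
    show "?tab (?doms g) = g"
    proof (rule nth_equalityI)
      fix i assume "i < length (?tab (?doms g))"
      then show "?tab (?doms g) ! i = g ! i"
        by (intro nth_equalityI) (simp_all add: g(2) label_dominoes[OF g(3)])
    qed (simp add: g(1))
  qed
  \<comment> \<open>The bounding row above the board has no upper halves, so its code is the row
    index 0.\<close>
  also have "\<dots> = ((RE0 n + RE0' n) ^\<^sub>m m) $$ (0, 0)"
    using RE_pow_entry[of "replicate n E" n m] by (simp add: code_replicate_False)
  finally show ?thesis .
qed

end
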